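(* Let $G$ be a group acting on a set $X$. If $\tau\in\mathrm{End}_G(X)$ is a fixing elementary collapsing, then $\tau$ is the only fixing elementary collapsing in its $\mathcal{H}$-class; that is, if $\tau,\eta\in\mathrm{End}_G(X)$ are fixing elementary collapsings with $\tau\sim_{\mathcal{H}}\eta$, then $\tau=\eta$.
   Context: $\mathrm{End}_G(X)$ is the monoid, under composition $(fg)(x)=f(g(x))$, of all $G$-equivariant functions $X\to X$. Write $S=\mathrm{End}_G(X)$. For $a,b\in S$: $a\sim_{\mathcal{L}} b$ means $Sa=Sb$; $a\sim_{\mathcal{R}} b$ means $aS=bS$; $a\sim_{\mathcal{H}} b$ means $a\sim_{\mathcal{L}} b$ and $a\sim_{\mathcal{R}} b$. $G_x$ is the stabilizer and $Gx$ the orbit of $x$. The kernel of $f:X\to X$ is $\ker(f)=\{(x,y)\in X\times X : f(x)=f(y)\}$. For a subgroup $K\le G$ and a subset $N\subseteq G$, $[K]_N=\{n^{-1}Kn : n\in N\}$; $N_H=N_G(H)$ is the normalizer of a subgroup $H\le G$. Definition. For subgroups $H,K\le G$, $\tau\in\mathrm{End}_G(X)$ is an elementary collapsing of type $(H,[K]_{N_H})$ if there exist $x,y\in X$ such that: (i) $Gx\neq Gy$; (ii) $G_x=H$; (iii) $[G_y]_{N_H}=[G_{\tau(x)}]_{N_H}=[K]_{N_H}$; (iv) $\ker(\tau)=\{(a,a): a\in X\}\cup\{(g\cdot x,g\cdot y),(g\cdot y,g\cdot x): g\in G\}\cup\{(g\cdot x,h\cdot x),(h\cdot x,g\cdot x):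 g,h\in G,\ h^{-1}g\in G_y\}$. It is a fixing elementary collapsing if (for some type) such $x,y$ can be chosen so that additionally $\{t\in X:\tau(t)=t\}=X\setminus Gx$. *)

theory Defs
  imports "HOL-Algebra.Group_Action"
begin

section \<open>The monoid of equivariant self-maps\<close>

text \<open>A function from \<open>X\<close> to itself is represented by its extensional representative, so that
  equality of elements of the monoid is equality of functions on \<open>X\<close>.\<close>

definition equivariant_End ::
    "('a, 'm) monoid_scheme \<Rightarrow> 'b set \<Rightarrow> ('a \<Rightarrow> 'b \<Rightarrow> 'b) \<Rightarrow> ('b \<Rightarrow> 'b) monoid" where
  "equivariant_End G X \<phi> =
     \<lparr>carrier = {f \<in> X \<rightarrow>\<^sub>E X. \<forall>g \<in> carrier G. \<forall>x \<in> X. f (\<phi> g x) = \<phi> g (f x)},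
      mult = compose X,
      one = (\<lambda>x \<in> X. x)\<rparr>"

lemma (in group_action) monoid_equivariant_End: "monoid (equivariant_End G E \<phi>)"
proof (rule monoidI)
  fix f g assume "f \<in> carrier (equivariant_End G E \<phi>)" "g \<in> carrier (equivariant_End G E \<phi>)"
  then show "f \<otimes>\<^bsub>equivariant_End G E \<phi>\<^esub> g \<in> carrier (equivariant_End G E \<phi>)"
    using element_image by (auto simp: equivariant_End_def compose_def PiE_iff)
next
  show "\<one>\<^bsub>equivariant_End G E \<phi>\<^esub> \<in> carrier (equivariant_End G E \<phi>)"
    using element_image by (auto simp: equivariant_End_def)
next
  fix f g h
  assume "f \<in> carrier (equivariant_End G E \<phi>)" "g \<in> carrier (equivariant_End G E \<phi>)"
    "h \<in> carrier (equivariant_End G E \<phi>)"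
  then show "f \<otimes>\<^bsub>equivariant_End G E \<phi>\<^esub> g \<otimes>\<^bsub>equivariant_End G E \<phi>\<^esub> h
      = f \<otimes>\<^bsub>equivariant_End G E \<phi>\<^esub> (g \<otimes>\<^bsub>equivariant_End G E \<phi>\<^esub> h)"
    by (auto simp: equivariant_End_def compose_def fun_eq_iff PiE_iff)
next
  fix f assume "f \<in> carrier (equivariant_End G E \<phi>)"
  then show "\<one>\<^bsub>equivariant_End G E \<phi>\<^esub> \<otimes>\<^bsub>equivariant_End G E \<phi>\<^esub> f = f"
    and "f \<otimes>\<^bsub>equivariant_End G E \<phi>\<^esub> \<one>\<^bsub>equivariant_End G E \<phi>\<^esub> = f"
    by (auto simp: equivariant_End_def compose_def fun_eq_iff PiE_iff extensional_def)
qed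


section \<open>Green's relations\<close>

text \<open>The coset notation of the library makes sense in any monoid: \<open>carrier S #>\<^bsub>S\<^esub> a\<close> is the
  principal left ideal \<open>Sa\<close>, and \<open>a <#\<^bsub>S\<^esub> carrier S\<close> is the principal right ideal \<open>aS\<close>.\<close>

definition green_L :: "('c, 'm) monoid_scheme \<Rightarrow> 'c \<Rightarrow> 'c \<Rightarrow> bool" where
  "green_L S a b \<longleftrightarrow> carrier S #>\<^bsub>S\<^esub> a = carrier S #>\<^bsub>S\<^esub> b"

definition green_R :: "('c, 'm) monoid_scheme \<Rightarrow> 'c \<Rightarrow> 'c \<Rightarrow> bool" where
  "green_R S a b \<longleftrightarrow> a <#\<^bsub>S\<^esub> carrier S = b <#\<^bsub>S\<^esub> carrier S"

definition green_H :: "('c, 'm) monoid_scheme \<Rightarrow> 'c \<Rightarrow> 'c \<Rightarrow> bool" where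
  "green_H S a b \<longleftrightarrow> green_L S a b \<and> green_R S a b"


section \<open>Elementary collapsings\<close>

definition ker_on :: "'b set \<Rightarrow> ('b \<Rightarrow> 'b) \<Rightarrow> ('b \<times> 'b) set" where
  "ker_on X f = {(x, y) \<in> X \<times> X. f x = f y}"

definition conjugates_by :: "('a, 'm) monoid_scheme \<Rightarrow> 'a set \<Rightarrow> 'a set \<Rightarrow> 'a set set" where
  "conjugates_by G K N = {inv\<^bsub>G\<^esub> n <#\<^bsub>G\<^esub> K #>\<^bsub>G\<^esub> n | n. n \<in> N}"

text \<open>\<open>\<tau>\<close> is an elementary collapsing of type \<open>(H, [K]\<^bsub>N(H)\<^esub>)\<close>, witnessed by the points \<open>x\<close>, \<open>y\<close>.\<close>

definition elementary_collapsing_at ::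
    "('a, 'm) monoid_scheme \<Rightarrow> 'b set \<Rightarrow> ('a \<Rightarrow> 'b \<Rightarrow> 'b) \<Rightarrow> 'a set \<Rightarrow> 'a set
      \<Rightarrow> ('b \<Rightarrow> 'b) \<Rightarrow> 'b \<Rightarrow> 'b \<Rightarrow> bool" where
  "elementary_collapsing_at G X \<phi> H K \<tau> x y \<longleftrightarrow>
     subgroup H G \<and> subgroup K G \<and>
     \<tau> \<in> carrier (equivariant_End G X \<phi>) \<and> x \<in> X \<and> y \<in> X \<and>
     orbit G \<phi> x \<noteq> orbit G \<phi> y \<and>
     stabilizer G \<phi> x = H \<and>
     conjugates_by G (stabilizer G \<phi> y) (normalizer G H)
       = conjugates_by G (stabilizer G \<phi> (\<tau> x)) (normalizer G H) \<and>
     conjugates_by G (stabilizer G \<phi> (\<tau> x)) (normalizer G H)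
       = conjugates_by G K (normalizer G H) \<and>
     ker_on X \<tau> =
       {(a, a) | a. a \<in> X}
       \<union> (\<Union>g \<in> carrier G. {(\<phi> g x, \<phi> g y), (\<phi> g y, \<phi> g x)})
       \<union> (\<Union>g \<in> carrier G. \<Union>h \<in> {h \<in> carrier G. inv\<^bsub>G\<^esub> h \<otimes>\<^bsub>G\<^esub> g \<in> stabilizer G \<phi> y}.
            {(\<phi> g x, \<phi> h x), (\<phi> h x, \<phi> g x)})"

definition elementary_collapsing ::
    "('a, 'm) monoid_scheme \<Rightarrow> 'b set \<Rightarrow> ('a \<Rightarrow> 'b \<Rightarrow> 'b) \<Rightarrow> 'a set \<Rightarrow> 'a set
      \<Rightarrow> ('b \<Rightarrow> 'b) \<Rightarrow> bool" where
  "elementary_collapsing G X \<phi> H K \<tau> \<longleftrightarrow>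
     (\<exists>x y. elementary_collapsing_at G X \<phi> H K \<tau> x y)"

definition fixing_elementary_collapsing ::
    "('a, 'm) monoid_scheme \<Rightarrow> 'b set \<Rightarrow> ('a \<Rightarrow> 'b \<Rightarrow> 'b) \<Rightarrow> ('b \<Rightarrow> 'b) \<Rightarrow> bool" where
  "fixing_elementary_collapsing G X \<phi> \<tau> \<longleftrightarrow>
     (\<exists>H K x y. elementary_collapsing_at G X \<phi> H K \<tau> x y \<and>
        {t \<in> X. \<tau> t = t} = X - orbit G \<phi> x)"

end

theory Submission
  imports Defs
begin

text \<open>A fixing elementary collapsing moves only the orbit of \<open>x\<close>, and moves it into the orbit of the
  fixed point \<open>y\<close>; hence it is idempotent, and an \<open>\<H>\<close>-class contains at most one idempotent.\<close>

text \<open>An idempotent \<open>b\<close> is a right identity on its left ideal, and an idempotent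
  \<open>a\<close> is a left identity on its right ideal. Since \<open>a\<close> lies in the former
  and \<open>b\<close> in the latter, \<open>a \<otimes> b\<close> equals both.\<close>

lemma (in monoid) green_H_idempotents_eq:
  assumes "a \<in> carrier G" "b \<in> carrier G" "a \<otimes> a = a" "b \<otimes> b = b" "green_H G a b"
  shows "a = b"
proof -
  \<comment> \<open>The unit puts each element into its own principal ideals; equality of the ideals
    then yields the factors \<open>s\<close> and \<open>t\<close>.\<close>
  have "a \<in> carrier G #> a"
    unfolding r_coset_def using l_one[OF assms(1)] by force
  then obtain s where s: "s \<in> carrier G" "a = s \<otimes> b"
    using assms(5) by (auto simp: green_H_def green_L_def r_coset_def)
  have "b \<in> b <# carrier G"
    unfolding l_coset_def using r_one[OF assms(2)] by force
  then obtain t where t: "t \<in> carrier G" "b = a \<otimes> t"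
    using assms(5) by (auto simp: green_H_def green_R_def l_coset_def)
  have "a \<otimes> b = s \<otimes> (b \<otimes> b)"
    unfolding s(2) by (rule m_assoc[OF s(1) assms(2,2)])
  then have "a \<otimes> b = a"
    using s(2) assms(4) by simp
  moreover have "a \<otimes> b = a \<otimes> a \<otimes> t"
    unfolding t(2) by (rule m_assoc[OF assms(1,1) t(1), symmetric])
  then have "a \<otimes> b = b"
    using t(2) assms(3) by simp
  ultimately show ?thesis by simp
qed

lemma (in group_action) fixing_elementary_collapsing_idempotent:
  assumes "fixing_elementary_collapsing G E \<phi> \<tau>"
  shows "\<tau> \<otimes>\<^bsub>equivariant_End G E \<phi>\<^esub> \<tau> = \<tau>"
proof -
  obtain H K x y where at: "elementary_collapsing_at G E \<phi> H K \<tau> x y"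
    and fix_eq: "{t \<in> E. \<tau> t = t} = E - orbit G \<phi> x"
    using assms unfolding fixing_elementary_collapsing_def by blast
  have xy: "x \<in> E" "y \<in> E" "orbit G \<phi> x \<noteq> orbit G \<phi> y"
    and \<tau>: "\<tau> \<in> E \<rightarrow>\<^sub>E E"
    and equiv: "\<And>g z. g \<in> carrier G \<Longrightarrow> z \<in> E \<Longrightarrow> \<tau> (\<phi> g z) = \<phi> g (\<tau> z)"
    using at by (auto simp: elementary_collapsing_at_def equivariant_End_def)
  have one: "\<one>\<^bsub>G\<^esub> \<in> carrier G"
    using group_hom group_hom.axioms(1) group.is_monoid monoid.one_closed by blast
  \<comment> \<open>This is the pair for the identity of \<open>G\<close> in the family of pairs
    (gx, gy) of the kernel; \<open>id_eq_one\<close> then removes the action of the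
    identity.\<close>
  have "(\<phi> \<one>\<^bsub>G\<^esub> x, \<phi> \<one>\<^bsub>G\<^esub> y) \<in> ker_on E \<tau>"
    using at one unfolding elementary_collapsing_at_def by blast
  then have "\<tau> x = \<tau> y"
    using xy by (simp add: ker_on_def id_eq_one[symmetric])
  \<comment> \<open>Distinct orbits are disjoint, so \<open>y\<close> lies outside the only orbit
    that \<tau> moves and is fixed.\<close>
  moreover have "y \<notin> orbit G \<phi> x"
  proof
    assume "y \<in> orbit G \<phi> x"
    then have "orbit G \<phi> x \<inter> orbit G \<phi> y \<noteq> {}"
      using orbit_refl[OF xy(2)] by blast
    then show False
      using disjoint_union xy unfolding orbits_def by blast
  qed
  then have "\<tau> y = y"
    using fix_eq xy(2) by blast
  ultimately have \<tau>x: "\<tau> x = y" and \<tau>y: "\<tau> y = y" by simp_all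
  \<comment> \<open>On the orbit of \<open>x\<close>, equivariance sends gx to gy, and gy to itself
    because \<open>y\<close> is fixed. Every other point is fixed already.\<close>
  have "\<tau> (\<tau> t) = \<tau> t" if t: "t \<in> E" for t
  proof (cases "t \<in> orbit G \<phi> x")
    case True
    then obtain g where "g \<in> carrier G" "t = \<phi> g x"
      unfolding orbit_def by blast
    then show ?thesis
      using equiv xy \<tau>x \<tau>y by simp
  next
    case False
    then have "\<tau> t = t" using fix_eq t by blast
    then show ?thesis by simp
  qed
  \<comment> \<open>Outside \<open>E\<close> both sides are \<open>undefined\<close>, so agreement
    on \<open>E\<close> is equality in the monoid.\<close>
  then show ?thesis
    using \<tau> by (auto simp: equivariant_End_def compose_def fun_eq_iff PiE_iff extensional_def)
qed

theorem theorem37: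
  fixes G :: "('a, 'm) monoid_scheme" and X :: "'b set" and \<phi> :: "'a \<Rightarrow> 'b \<Rightarrow> 'b"
    and \<tau> \<eta> :: "'b \<Rightarrow> 'b"
  assumes "group_action G X \<phi>"
    and "\<tau> \<in> carrier (equivariant_End G X \<phi>)"
    and "\<eta> \<in> carrier (equivariant_End G X \<phi>)"
    and "fixing_elementary_collapsing G X \<phi> \<tau>"
    and "fixing_elementary_collapsing G X \<phi> \<eta>"
    and "green_H (equivariant_End G X \<phi>) \<tau> \<eta>"
  shows "\<tau> = \<eta>"
proof -
  let ?S = "equivariant_End G X \<phi>"
  show ?thesis
  proof (rule monoid.green_H_idempotents_eq)
    show "monoid ?S"
      by (rule group_action.monoid_equivariant_End[OF assms(1)])
    show "\<tau> \<otimes>\<^bsub>?S\<^esub> \<tau> = \<tau>" "\<eta> \<otimes>\<^bsub>?S\<^esub> \<eta> = \<eta>"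
      using group_action.fixing_elementary_collapsing_idempotent[OF assms(1)] assms(4,5)
      by blast+
  qed (use assms in auto)
qed

end
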